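(* Let $\alpha,\gamma,\delta>0$. The three-parameter metric on the extended Siegel--Jacobi upper half-plane $\tilde{\mathcal{X}}^J_1$, in the S-coordinates $(x,y,p,q,\kappa)$, $$ds^2_{\tilde{\mathcal{X}}^J_1}=\frac{\alpha}{y^2}(dx^2+dy^2)+\left[\frac{\gamma}{y}(x^2+y^2)+\delta q^2\right]dp^2+\left(\frac{\gamma}{y}+\delta p^2\right)dq^2+\delta\,d\kappa^2+2\left(\gamma\frac{x}{y}-\delta pq\right)dp\,dq+2\delta(q\,dp\,d\kappa-p\,dq\,d\kappa)$$ is left-invariant with respect to the action of the Jacobi group $G^J_1(\mathbb{R})$ on $\tilde{\mathcal{X}}^J_1$. Moreover, the fundamental vector fields $$F^*=\partial_x-p\,\partial_q,\quad G^*=(y^2-x^2)\partial_x-2xy\,\partial_y-q\,\partial_p,\quad H^*=2(x\,\partial_x+y\,\partial_y)-p\,\partial_p+q\,\partial_q,$$ $$P^*=\partial_p+q\,\partial_\kappa,\quad Q^*=\partial_q-p\,\partial_\kappa,\quad R^*=\partial_\kappa$$ satisfy the Killing equations with respect to this metric: each such $X=X^1\partial_x+X^2\partial_y+X^3\partial_p+X^4\partial_q+X^5\partial_\kappa$ verifies $$X^{\mu}\partial_{\mu}g_{\lambda\chi}+g_{\mu\chi}\partial_{\lambda}X^{\mu}+g_{\lambda\mu}\partial_{\chi}X^{\mu}=0,\qquad \lambda,\chi=1,\dots,5$$ (summation over $\mu=1,\dots,5$), where $g_{\lambda\chi}$ are the components of the metric above.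
   Context: The real Jacobi group $G^J_1(\mathbb{R})=\mathrm{SL}(2,\mathbb{R})\ltimes\mathrm{H}_1$ consists of triples $(M,X,\kappa)$, $M=\begin{pmatrix}a&b\\c&d\end{pmatrix}\in\mathrm{SL}(2,\mathbb{R})$, $X=(\lambda,\mu)\in\mathbb{R}^2$, $\kappa\in\mathbb{R}$, with composition law $(M,X,\kappa)(M',X',\kappa')=\left(MM',\,XM'+X',\,\kappa+\kappa'+\det\begin{pmatrix}XM'\\ X'\end{pmatrix}\right)$; put $(p,q)=XM^{-1}$. $\tilde{\mathcal{X}}^J_1=\frac{G^J_1(\mathbb{R})}{\mathrm{SO}(2)}=\{(x,y,p,q,\kappa)\in\mathbb{R}^5:y>0\}$, and $(M,X,\kappa)$ sends $(x',y',p',q',\kappa')$ to $(x_1,y_1,p_1,q_1,\kappa_1)$ with $\tau'=x'+\mathrm{i}y'$, $x_1+\mathrm{i}y_1=\frac{a\tau'+b}{c\tau'+d}$, $(p_1,q_1)=(p,q)+(p',q')M^{-1}$, $\kappa_1=\kappa+\kappa'+\lambda q'-\mu p'$. For $X\in\mathfrak{g}^J_1(\mathbb{R})$ the fundamental vector field $X^*$ is $X^*_m=\frac{d}{dt}(\exp(tX)\times m)|_{t=0}$. The starred fields in the claim are the fundamental vector fields of the generators of $\mathfrak{g}^J_1(\mathbb{R})$: $F=\begin{pmatrix}0&1\\0&0\end{pmatrix}$, $G=\begin{pmatrix}0&0\\1&0\end{pmatrix}$, $H=\begin{pmatrix}1&0\\0&-1\end{pmatrix}$ of $\mathfrak{sl}(2,\mathbb{R})$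 and $P,Q,R$ the generators of the $\lambda$-, $\mu$-, $\kappa$-directions of the Heisenberg algebra. *)

theory Defs
  imports "HOL-Analysis.Analysis"
begin

section \<open>Vectors with five components\<close>

lemma UNIV_5: "(UNIV :: 5 set) = {1, 2, 3, 4, 5}"
proof -
  have d: "distinct [1, 2, 3, 4, 5 :: 5]" by simp
  have "card {1, 2, 3, 4, 5 :: 5} = card (UNIV :: 5 set)"
    using distinct_card[OF d] by simp
  then show ?thesis
    by (metis card_subset_eq finite subset_UNIV)
qed

lemma forall_5: "(\<forall>i::5. P i) \<longleftrightarrow> P 1 \<and> P 2 \<and> P 3 \<and> P 4 \<and> P 5"
  using UNIV_5 by (metis (no_types, lifting) UNIV_I empty_iff insert_iff)

lemma sum_5: "sum f (UNIV :: 5 set) = f 1 + f 2 + f 3 + f 4 + f 5"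
  unfolding UNIV_5 by (simp add: add.assoc)

lemma vector_5 [simp]:
  "(vector [a, b, c, d, e] :: ('a::zero)^5) $ 1 = a"
  "(vector [a, b, c, d, e] :: ('a::zero)^5) $ 2 = b"
  "(vector [a, b, c, d, e] :: ('a::zero)^5) $ 3 = c"
  "(vector [a, b, c, d, e] :: ('a::zero)^5) $ 4 = d"
  "(vector [a, b, c, d, e] :: ('a::zero)^5) $ 5 = e"
  unfolding vector_def by simp_all


section \<open>The real Jacobi group\<close>

type_synonym jacobi = "(real^2^2) \<times> (real^2) \<times> real"

text \<open>
  \<^typ>\<open>jacobi\<close> is the ambient real vector space of dimension 7. The Jacobi group is the subset
  \<open>jacobi_group\<close>; its Lie algebra \<open>jacobi_algebra\<close> is the tangent space at the identity. In a
  triple \<open>(M, X, \<kappa>)\<close> the pair \<open>X = (\<lambda>, \<mu>)\<close> is a row vector, so matrices act on it by \<open>v*\<close>.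
\<close>

definition jacobi_group :: "jacobi set" where
  "jacobi_group = {(M, X, \<kappa>). det M = 1}"

definition jacobi_algebra :: "jacobi set" where
  "jacobi_algebra = {(A, Y, r). trace A = 0}"

fun jacobi_mult :: "jacobi \<Rightarrow> jacobi \<Rightarrow> jacobi" where
  "jacobi_mult (M, X, \<kappa>) (M', X', \<kappa>') =
     (M ** M', X v* M' + X', \<kappa> + \<kappa>' + det (vector [X v* M', X'] :: real^2^2))"

text \<open>
  The exponential map is the one of Lie group theory: \<open>exp A = \<phi> 1\<close>, where \<open>\<phi>\<close> is the unique
  one-parameter subgroup with initial velocity \<open>A\<close>. A homomorphism that is differentiable at \<open>0\<close>
  is automatically smooth.
\<close>

definition one_parameter_subgroup :: "jacobi \<Rightarrow> (real \<Rightarrow> jacobi) \<Rightarrow> bool" where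
  "one_parameter_subgroup A \<phi> \<longleftrightarrow>
     (\<forall>t. \<phi> t \<in> jacobi_group) \<and>
     (\<forall>s t. \<phi> (s + t) = jacobi_mult (\<phi> s) (\<phi> t)) \<and>
     (\<phi> has_vector_derivative A) (at 0)"

definition jacobi_exp :: "jacobi \<Rightarrow> jacobi" where
  "jacobi_exp A = (THE \<phi>. one_parameter_subgroup A \<phi>) 1"

definition gen_F :: jacobi where "gen_F = (vector [vector [0, 1], vector [0, 0]], 0, 0)"
definition gen_G :: jacobi where "gen_G = (vector [vector [0, 0], vector [1, 0]], 0, 0)"
definition gen_H :: jacobi where "gen_H = (vector [vector [1, 0], vector [0, - 1]], 0, 0)"
definition gen_P :: jacobi where "gen_P = (0, vector [1, 0], 0)"
definition gen_Q :: jacobi where "gen_Q = (0, vector [0, 1], 0)"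
definition gen_R :: jacobi where "gen_R = (0, 0, 1)"

lemma gens_in_jacobi_algebra: "{gen_F, gen_G, gen_H, gen_P, gen_Q, gen_R} \<subseteq> jacobi_algebra"
  by (simp add: jacobi_algebra_def gen_F_def gen_G_def gen_H_def gen_P_def gen_Q_def gen_R_def
      trace_def sum_2)


section \<open>The extended Siegel--Jacobi upper half-plane\<close>

text \<open>The S-coordinates \<open>(x, y, p, q, \<kappa>)\<close> of \<open>m\<close> are \<open>m $ 1, \<dots>, m $ 5\<close>.\<close>

definition ext_SJ :: "(real^5) set" where
  "ext_SJ = {m. m $ 2 > 0}"

fun jacobi_act :: "jacobi \<Rightarrow> real^5 \<Rightarrow> real^5" where
  "jacobi_act (M, X, \<kappa>) m =
     (let \<tau>' = Complex (m $ 1) (m $ 2);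
          \<tau> = (complex_of_real (M $ 1 $ 1) * \<tau>' + complex_of_real (M $ 1 $ 2)) /
              (complex_of_real (M $ 2 $ 1) * \<tau>' + complex_of_real (M $ 2 $ 2));
          pq' = (vector [m $ 3, m $ 4] :: real^2);
          pq = X v* matrix_inv M + pq' v* matrix_inv M
      in vector [Re \<tau>, Im \<tau>, pq $ 1, pq $ 2,
                 \<kappa> + m $ 5 + X $ 1 * m $ 4 - X $ 2 * m $ 3])"

text \<open>
  \<open>jacobi_act\<close> is a transitive action of the Jacobi group on \<open>ext_SJ\<close>, and the base point
  \<open>(0, 1, 0, 0, 0)\<close> has stabilizer \<open>SO(2)\<close>; this identifies \<open>ext_SJ\<close> with the homogeneous space
  of the Jacobi group by \<open>SO(2)\<close>.
\<close>

lemma matrix_inv_SL2: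
  fixes M :: "real^2^2"
  assumes "det M = 1"
  shows "matrix_inv M = vector [vector [M $ 2 $ 2, - M $ 1 $ 2], vector [- M $ 2 $ 1, M $ 1 $ 1]]"
proof -
  let ?N = "vector [vector [M $ 2 $ 2, - M $ 1 $ 2], vector [- M $ 2 $ 1, M $ 1 $ 1]] :: real^2^2"
  have N: "M ** ?N = mat 1" using assms
    by (simp add: vec_eq_iff forall_2 matrix_matrix_mult_def sum_2 mat_def det_2 algebra_simps)
  then have "?N ** M = mat 1" by (rule iffD1[OF matrix_left_right_inverse])
  then have "invertible M" using N invertible_def by blast
  then have I: "matrix_inv M ** M = mat 1"
    unfolding invertible_def matrix_inv_def
    by (rule someI2_ex) simp
  have "matrix_inv M = matrix_inv M ** (M ** ?N)" by (simp only: N matrix_mul_rid)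
  also have "\<dots> = ?N" by (simp only: matrix_mul_assoc I matrix_mul_lid)
  finally show ?thesis .
qed

lemma SL2_denominator_nonzero:
  assumes "det (M::real^2^2) = 1" "Im z > 0"
  shows "complex_of_real (M $ 2 $ 1) * z + complex_of_real (M $ 2 $ 2) \<noteq> 0"
  using assms by (auto simp: complex_eq_iff det_2)

lemma jacobi_act_closed:
  assumes "g \<in> jacobi_group" "m \<in> ext_SJ"
  shows "jacobi_act g m \<in> ext_SJ"
proof -
  obtain M X k where g: "g = (M, X, k)" by (cases g)
  have d: "det M = 1" and y: "m $ 2 > 0" using assms g by (auto simp: jacobi_group_def ext_SJ_def)
  have "(complex_of_real (M $ 2 $ 1) * Complex (m $ 1) (m $ 2) + complex_of_real (M $ 2 $ 2)) \<noteq> 0"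
    using SL2_denominator_nonzero[OF d] y by simp
  then have *: "(M $ 2 $ 1 * m $ 1 + M $ 2 $ 2)\<^sup>2 + (M $ 2 $ 1 * m $ 2)\<^sup>2 > 0"
    by (simp add: complex_eq_iff sum_power2_gt_zero_iff)
  have **: "M $ 1 $ 1 * m $ 2 * (M $ 2 $ 1 * m $ 1 + M $ 2 $ 2) -
      (M $ 1 $ 1 * m $ 1 + M $ 1 $ 2) * (M $ 2 $ 1 * m $ 2) = m $ 2"
    using d by (simp add: det_2) algebra
  show ?thesis
    by (simp add: g ext_SJ_def Let_def Im_divide ** *) (use * ** y in \<open>simp\<close>)
qed

lemma jacobi_act_mult:
  assumes "g \<in> jacobi_group" "h \<in> jacobi_group" "m \<in> ext_SJ"
  shows "jacobi_act (jacobi_mult g h) m = jacobi_act g (jacobi_act h m)"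
proof -
  obtain M X k where g: "g = (M, X, k)" by (cases g)
  obtain N Y l where h: "h = (N, Y, l)" by (cases h)
  have d: "det M = 1" "det N = 1" "det (M ** N) = 1" and y: "m $ 2 > 0"
    using assms g h by (auto simp: jacobi_group_def ext_SJ_def det_mul)
  note inv = d[THEN matrix_inv_SL2]
  note d2 = d(1,2)[unfolded det_2]
  define \<tau> where "\<tau> = Complex (m $ 1) (m $ 2)"
  have n: "complex_of_real (N $ 2 $ 1) * \<tau> + complex_of_real (N $ 2 $ 2) \<noteq> 0"
      "complex_of_real ((M ** N) $ 2 $ 1) * \<tau> + complex_of_real ((M ** N) $ 2 $ 2) \<noteq> 0"
    using SL2_denominator_nonzero[OF d(2), of \<tau>] SL2_denominator_nonzero[OF d(3), of \<tau>] y by (auto simp: \<tau>_def)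
  define \<sigma> where "\<sigma> = (complex_of_real (N $ 1 $ 1) * \<tau> + complex_of_real (N $ 1 $ 2)) /
      (complex_of_real (N $ 2 $ 1) * \<tau> + complex_of_real (N $ 2 $ 2))"
  have mob: "(complex_of_real ((M ** N) $ 1 $ 1) * \<tau> + complex_of_real ((M ** N) $ 1 $ 2)) /
     (complex_of_real ((M ** N) $ 2 $ 1) * \<tau> + complex_of_real ((M ** N) $ 2 $ 2)) =
     (complex_of_real (M $ 1 $ 1) * \<sigma> + complex_of_real (M $ 1 $ 2)) /
      (complex_of_real (M $ 2 $ 1) * \<sigma> + complex_of_real (M $ 2 $ 2))" (is "?a / ?b = ?c / ?d")
  proof -
    let ?e = "complex_of_real (N $ 2 $ 1) * \<tau> + complex_of_real (N $ 2 $ 2)"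
    have "?a = ?e * ?c" "?b = ?e * ?d" using n(1)
      by (simp_all add: \<sigma>_def matrix_matrix_mult_def sum_2 field_simps)
    then show ?thesis using n(1) by simp
  qed
  have c3: "jacobi_act (jacobi_mult g h) m $ 3 = jacobi_act g (jacobi_act h m) $ 3"
    by (simp add: g h Let_def inv)
      (simp add: matrix_matrix_mult_def vector_matrix_mult_def sum_2 det_2, use d2 in algebra)
  have c4: "jacobi_act (jacobi_mult g h) m $ 4 = jacobi_act g (jacobi_act h m) $ 4"
    by (simp add: g h Let_def inv)
      (simp add: matrix_matrix_mult_def vector_matrix_mult_def sum_2 det_2, use d2 in algebra)
  have c5: "jacobi_act (jacobi_mult g h) m $ 5 = jacobi_act g (jacobi_act h m) $ 5"
    by (simp add: g h Let_def inv)
      (simp add: matrix_matrix_mult_def vector_matrix_mult_def sum_2 det_2 algebra_simps)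
  have c12: "jacobi_act (jacobi_mult g h) m $ 1 = jacobi_act g (jacobi_act h m) $ 1"
    "jacobi_act (jacobi_mult g h) m $ 2 = jacobi_act g (jacobi_act h m) $ 2"
    using mob by (simp_all add: g h Let_def flip: \<tau>_def \<sigma>_def)
  show ?thesis by (simp add: vec_eq_iff forall_5 c12 c3 c4 c5)
qed

lemma jacobi_act_base:
  assumes "det M = 1"
  shows "jacobi_act (M, X, \<kappa>) (vector [0, 1, 0, 0, 0]) =
     vector [(M$1$1 * M$2$1 + M$1$2 * M$2$2) / ((M$2$1)\<^sup>2 + (M$2$2)\<^sup>2), 1 / ((M$2$1)\<^sup>2 + (M$2$2)\<^sup>2),
        X$1 * M$2$2 - X$2 * M$2$1, X$2 * M$1$1 - X$1 * M$1$2, \<kappa>]"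
proof -
  have "M $ 1 $ 1 * M $ 2 $ 2 - M $ 1 $ 2 * M $ 2 $ 1 = 1"
    using assms by (simp add: det_2)
  moreover have "complex_of_real a * Complex 0 1 + complex_of_real b = Complex b a" for a b
    by (simp add: complex_eq_iff)
  ultimately show ?thesis
    by (simp only: jacobi_act.simps Let_def matrix_inv_SL2[OF assms] vec_eq_iff forall_5 vector_5
        vector_2 Re_divide Im_divide complex.sel vector_matrix_mult_def vec_lambda_beta sum_2)
      (simp add: algebra_simps)
qed

lemma jacobi_act_transitive:
  assumes "m \<in> ext_SJ"
  shows "\<exists>g\<in>jacobi_group. jacobi_act g (vector [0, 1, 0, 0, 0]) = m"
proof -
  define s where "s = sqrt (m $ 2)"
  have s: "s > 0" "m $ 2 = s\<^sup>2" using assms by (auto simp: s_def ext_SJ_def)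
  define M :: "real^2^2" where "M = vector [vector [s, m $ 1 / s], vector [0, 1 / s]]"
  define X :: "real^2" where "X = vector [m $ 3 * s, m $ 3 * m $ 1 / s + m $ 4 / s]"
  have d: "det M = 1" using s by (simp add: M_def det_2)
  have "jacobi_act (M, X, m $ 5) (vector [0, 1, 0, 0, 0]) = m"
    unfolding jacobi_act_base[OF d] using s(1)
    by (simp add: vec_eq_iff forall_5 M_def X_def s(2) field_simps power2_eq_square)
  then show ?thesis using d by (intro bexI[of _ "(M, X, m $ 5)"]) (auto simp: jacobi_group_def)
qed

lemma jacobi_act_stabilizer:
  assumes "g \<in> jacobi_group"
  shows "jacobi_act g (vector [0, 1, 0, 0, 0]) = vector [0, 1, 0, 0, 0] \<longleftrightarrow>
    (\<exists>M. orthogonal_matrix M \<and> det M = 1 \<and> g = (M, 0, 0))"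
proof -
  obtain M X k where g: "g = (M, X, k)" by (cases g)
  have d: "det M = 1" using assms g by (auto simp: jacobi_group_def)
  note d2 = d[unfolded det_2]
  let ?D = "(M$2$1)\<^sup>2 + (M$2$2)\<^sup>2"
  have D: "?D > 0" using d2 by (auto simp: sum_power2_gt_zero_iff)
  have "orthogonal_matrix M \<longleftrightarrow> M$1$1 * M$2$1 + M$1$2 * M$2$2 = 0 \<and> ?D = 1" (is "_ \<longleftrightarrow> ?r")
  proof
    assume "orthogonal_matrix M"
    then have "M ** transpose M = mat 1" by (simp add: orthogonal_matrix_def)
    then show ?r
      by (simp add: vec_eq_iff forall_2 matrix_matrix_mult_def sum_2 mat_def transpose_def power2_eq_square)
  next
    assume r: ?r
    then have e: "M$1$1 = M$2$2" "M$1$2 = - M$2$1" using d2 by algebra+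
    then show "orthogonal_matrix M" using r
      by (simp add: orthogonal_matrix vec_eq_iff forall_2 matrix_matrix_mult_def sum_2 mat_def transpose_def power2_eq_square)
  qed
  moreover have "X = 0 \<longleftrightarrow> X$1 * M$2$2 - X$2 * M$2$1 = 0 \<and> X$2 * M$1$1 - X$1 * M$1$2 = 0" (is "_ \<longleftrightarrow> ?q")
  proof
    assume ?q
    then have "X $ 1 = 0" "X $ 2 = 0" using d2 by algebra+
    then show "X = 0" by (simp add: vec_eq_iff forall_2)
  qed simp
  moreover have "jacobi_act g (vector [0, 1, 0, 0, 0]) = vector [0, 1, 0, 0, 0] \<longleftrightarrow>
      M$1$1 * M$2$1 + M$1$2 * M$2$2 = 0 \<and> ?D = 1 \<and>
      X$1 * M$2$2 - X$2 * M$2$1 = 0 \<and> X$2 * M$1$1 - X$1 * M$1$2 = 0 \<and> k = 0"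
  proof -
    have "a / ?D = 0 \<longleftrightarrow> a = 0" "1 / ?D = 1 \<longleftrightarrow> ?D = 1" for a
      using D by (auto simp del: zero_less_power2)
    then show ?thesis
      unfolding g jacobi_act_base[OF d] vec_eq_iff forall_5 vector_5 by blast
  qed
  ultimately show ?thesis using d unfolding g by blast
qed

definition fundamental_vector_field :: "jacobi \<Rightarrow> (real^5 \<Rightarrow> real^5) \<Rightarrow> bool" where
  "fundamental_vector_field A V \<longleftrightarrow>
     (\<forall>m\<in>ext_SJ. ((\<lambda>t. jacobi_act (jacobi_exp (t *\<^sub>R A)) m) has_vector_derivative V m) (at 0))"


section \<open>Invariant metrics and the Killing equations\<close>

text \<open>A metric is given by its matrix of components \<open>g m $ \<lambda> $ \<chi>\<close> at each point \<open>m\<close>.\<close>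

definition left_invariant_metric :: "(real^5 \<Rightarrow> real^5^5) \<Rightarrow> bool" where
  "left_invariant_metric g \<longleftrightarrow>
     (\<forall>h\<in>jacobi_group. \<forall>m\<in>ext_SJ.
        jacobi_act h m \<in> ext_SJ \<and>
        (\<exists>D. (jacobi_act h has_derivative D) (at m) \<and>
             (\<forall>u v. D u \<bullet> (g (jacobi_act h m) *v D v) = u \<bullet> (g m *v v))))"

definition partial :: "5 \<Rightarrow> (real^5 \<Rightarrow> real) \<Rightarrow> real^5 \<Rightarrow> real" where
  "partial i f m = frechet_derivative f (at m) (axis i 1)"

definition killing_equations :: "(real^5 \<Rightarrow> real^5^5) \<Rightarrow> (real^5 \<Rightarrow> real^5) \<Rightarrow> bool" where
  "killing_equations g V \<longleftrightarrow>
     (\<forall>m\<in>ext_SJ. \<forall>l c.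
        (\<Sum>k\<in>UNIV. V m $ k * partial k (\<lambda>z. g z $ l $ c) m
                   + g m $ k $ c * partial l (\<lambda>z. V z $ k) m
                   + g m $ l $ k * partial c (\<lambda>z. V z $ k) m) = 0)"


section \<open>The three-parameter metric\<close>

definition SJ_line_element :: "real \<Rightarrow> real \<Rightarrow> real \<Rightarrow> real^5 \<Rightarrow> real^5 \<Rightarrow> real" where
  "SJ_line_element \<alpha> \<gamma> \<delta> m v =
     (let x = m $ 1; y = m $ 2; p = m $ 3; q = m $ 4;
          dx = v $ 1; dy = v $ 2; dp = v $ 3; dq = v $ 4; d\<kappa> = v $ 5
      in \<alpha> / y\<^sup>2 * (dx\<^sup>2 + dy\<^sup>2) + (\<gamma> / y * (x\<^sup>2 + y\<^sup>2) + \<delta> * q\<^sup>2) * dp\<^sup>2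
         + (\<gamma> / y + \<delta> * p\<^sup>2) * dq\<^sup>2 + \<delta> * d\<kappa>\<^sup>2
         + 2 * (\<gamma> * (x / y) - \<delta> * p * q) * dp * dq
         + 2 * \<delta> * (q * dp * d\<kappa> - p * dq * d\<kappa>))"

definition SJ_metric :: "real \<Rightarrow> real \<Rightarrow> real \<Rightarrow> real^5 \<Rightarrow> real^5^5" where
  "SJ_metric \<alpha> \<gamma> \<delta> m =
     (let x = m $ 1; y = m $ 2; p = m $ 3; q = m $ 4
      in vector
        [vector [\<alpha> / y\<^sup>2, 0, 0, 0, 0],
         vector [0, \<alpha> / y\<^sup>2, 0, 0, 0],
         vector [0, 0, \<gamma> / y * (x\<^sup>2 + y\<^sup>2) + \<delta> * q\<^sup>2, \<gamma> * (x / y) - \<delta> * p * q, \<delta> * q],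
         vector [0, 0, \<gamma> * (x / y) - \<delta> * p * q, \<gamma> / y + \<delta> * p\<^sup>2, - \<delta> * p],
         vector [0, 0, \<delta> * q, - \<delta> * p, \<delta>]])"

lemma SJ_metric_symmetric: "transpose (SJ_metric \<alpha> \<gamma> \<delta> m) = SJ_metric \<alpha> \<gamma> \<delta> m"
  by (simp add: vec_eq_iff forall_5 transpose_def SJ_metric_def Let_def)

lemma SJ_metric_line_element:
  "v \<bullet> (SJ_metric \<alpha> \<gamma> \<delta> m *v v) = SJ_line_element \<alpha> \<gamma> \<delta> m v"
  unfolding SJ_metric_def SJ_line_element_def Let_def inner_vec_def matrix_vector_mult_def sum_5
  by (simp add: algebra_simps power2_eq_square)

lemma SJ_line_element_squares:
  assumes "m $ 2 > 0"
  shows "SJ_line_element \<alpha> \<gamma> \<delta> m v =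
    \<alpha> / (m $ 2)\<^sup>2 * ((v $ 1)\<^sup>2 + (v $ 2)\<^sup>2)
    + \<gamma> / m $ 2 * ((m $ 1 * v $ 3 + v $ 4)\<^sup>2 + (m $ 2 * v $ 3)\<^sup>2)
    + \<delta> * (v $ 5 + m $ 4 * v $ 3 - m $ 3 * v $ 4)\<^sup>2"
  using assms unfolding SJ_line_element_def Let_def
  by (simp add: field_simps power2_eq_square)

lemma SJ_metric_pos:
  assumes "\<alpha> > 0" "\<gamma> > 0" "\<delta> > 0" "m \<in> ext_SJ" "v \<noteq> 0"
  shows "v \<bullet> (SJ_metric \<alpha> \<gamma> \<delta> m *v v) > 0"
proof -
  have y: "m $ 2 > 0" using assms by (simp add: ext_SJ_def)
  define A B C where
    "A = \<alpha> / (m $ 2)\<^sup>2 * ((v $ 1)\<^sup>2 + (v $ 2)\<^sup>2)" and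
    "B = \<gamma> / m $ 2 * ((m $ 1 * v $ 3 + v $ 4)\<^sup>2 + (m $ 2 * v $ 3)\<^sup>2)" and
    "C = \<delta> * (v $ 5 + m $ 4 * v $ 3 - m $ 3 * v $ 4)\<^sup>2"
  have nonneg: "A \<ge> 0" "B \<ge> 0" "C \<ge> 0"
    using assms y by (auto simp: A_def B_def C_def)
  have "A + B + C \<noteq> 0"
  proof
    assume "A + B + C = 0"
    then have z: "A = 0" "B = 0" "C = 0" using nonneg by linarith+
    have "v $ 1 = 0 \<and> v $ 2 = 0"
      using z(1) assms y by (simp add: A_def sum_power2_eq_zero_iff)
    moreover have "v $ 3 = 0 \<and> v $ 4 = 0"
      using z(2) assms y by (auto simp: B_def sum_power2_eq_zero_iff)
    moreover from this have "v $ 5 = 0"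
      using z(3) assms by (simp add: C_def)
    ultimately have "v = 0" by (simp add: vec_eq_iff forall_5)
    with assms show False by simp
  qed
  then show ?thesis
    using nonneg by (simp add: SJ_metric_line_element SJ_line_element_squares[OF y] A_def B_def C_def)
qed

definition F_star :: "real^5 \<Rightarrow> real^5" where
  "F_star m = vector [1, 0, 0, - m $ 3, 0]"

definition G_star :: "real^5 \<Rightarrow> real^5" where
  "G_star m = vector [(m $ 2)\<^sup>2 - (m $ 1)\<^sup>2, - 2 * m $ 1 * m $ 2, - m $ 4, 0, 0]"

definition H_star :: "real^5 \<Rightarrow> real^5" where
  "H_star m = vector [2 * m $ 1, 2 * m $ 2, - m $ 3, m $ 4, 0]"

definition P_star :: "real^5 \<Rightarrow> real^5" where
  "P_star m = vector [0, 0, 1, 0, m $ 4]"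

definition Q_star :: "real^5 \<Rightarrow> real^5" where
  "Q_star m = vector [0, 0, 0, 1, - m $ 3]"

definition R_star :: "real^5 \<Rightarrow> real^5" where
  "R_star m = vector [0, 0, 0, 0, 1]"

end

theory Submission
  imports Defs
begin

text \<open>
  The metric is \<open>\<alpha> |d\<tau>|\<^sup>2 / y\<^sup>2 + \<gamma> |\<tau> dp + dq|\<^sup>2 / y + \<delta> (d\<kappa> + q dp - p dq)\<^sup>2\<close> with \<open>\<tau> = x + iy\<close>.
  For \<open>j = c\<tau> + d\<close>, the action multiplies \<open>d\<tau>\<close> by \<open>j\<close> to the power \<open>-2\<close>, \<open>\<tau> dp + dq\<close> by the inverse
  of \<open>j\<close> and \<open>y\<close> by the inverse of \<open>|j|\<^sup>2\<close>, and fixes the last one-form; so each summand is invariant.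

  For the fundamental fields, a one-parameter subgroup is determined by its velocity: if \<open>\<phi>\<close> and
  \<open>\<psi>\<close> have the same one, the curve \<open>\<phi> t \<cdot> \<psi> (- t)\<close> has derivative zero at \<open>0\<close>, hence, by
  translation, everywhere. So the exponentials of the generators can be written down explicitly.
\<close>

subsection \<open>One-parameter subgroups\<close>

lemmas has_derivative_vec_nth [derivative_intros] =
  bounded_linear.has_derivative[OF bounded_linear_vec_nth]

text \<open>Basis elements of a vector type have the form \<open>axis i u\<close>, so a scalar
  component of \<open>f\<close> is the inner product of one entry with \<open>u\<close>. Applied
  twice, this reduces matrices to their entries.\<close>

lemma has_derivative_vecI:
  fixes f :: "'a::real_normed_vector \<Rightarrow> ('b::euclidean_space)^'n"
  assumes "\<And>i. ((\<lambda>x. f x $ i) has_derivative (\<lambda>h. f' h $ i)) (at a)"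
  shows "(f has_derivative f') (at a)"
  unfolding has_derivative_componentwise_within[of f]
proof
  fix b :: "'b^'n" assume "b \<in> Basis"
  then obtain i u where "b = axis i u" by (auto simp: Basis_vec_def)
  with assms[of i] show "((\<lambda>x. f x \<bullet> b) has_derivative (\<lambda>h. f' h \<bullet> b)) (at a)"
    by (simp add: inner_axis has_derivative_inner_left)
qed

lemma differentiable_vec_nth:
  assumes "f differentiable F"
  shows "(\<lambda>x. f x $ i :: 'b::real_normed_vector) differentiable F"
  using assms bounded_linear.has_derivative[OF bounded_linear_vec_nth]
  unfolding differentiable_def by blast

lemma differentiable_vecI:
  fixes f :: "'a::real_normed_vector \<Rightarrow> ('b::euclidean_space)^'n"
  assumes "\<And>i. (\<lambda>x. f x $ i) differentiable (at a)"
  shows "f differentiable (at a)"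
proof -
  obtain D where "((\<lambda>x. f x $ i) has_derivative D i) (at a)" for i
    using assms unfolding differentiable_def by metis
  then have "(f has_derivative (\<lambda>h. \<chi> i. D i h)) (at a)"
    by (intro has_derivative_vecI) simp
  then show ?thesis unfolding differentiable_def by blast
qed

lemma differentiable_fst_snd:
  assumes "f differentiable F"
  shows "(\<lambda>x. fst (f x)) differentiable F" "(\<lambda>x. snd (f x)) differentiable F"
  using assms has_derivative_fst has_derivative_snd unfolding differentiable_def by blast+

section \<open>The group law\<close>

lemma jacobi_mult_differentiable:
  assumes "f differentiable (at a)" "g differentiable (at a)"
  shows "(\<lambda>x. jacobi_mult (f x) (g x)) differentiable (at a)"
proof -
  \<comment> \<open>Written with projections, each component of the product is visibly polynomial in
    the entries of the factors.\<close>
  have eq: "jacobi_mult h k = (fst h ** fst k, fst (snd h) v* fst k + fst (snd k),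
      snd (snd h) + snd (snd k) + det (vector [fst (snd h) v* fst k, fst (snd k)] :: real^2^2))" for h k
    by (cases h, cases k) simp
  note c = assms[THEN differentiable_fst_snd(1)]
    assms[THEN differentiable_fst_snd(2), THEN differentiable_fst_snd(1)]
    assms[THEN differentiable_fst_snd(2), THEN differentiable_fst_snd(2)]
  note d = c c(1,2)[THEN differentiable_vec_nth, THEN differentiable_vec_nth]
     c(3,4)[THEN differentiable_vec_nth]
  show ?thesis unfolding eq
    by (intro differentiable_Pair differentiable_vecI)
      (simp_all add: matrix_matrix_mult_def vector_matrix_mult_def det_2 sum_2 d)
qed

text \<open>The determinant condition on \<open>k\<close> enters in the last component: right
  multiplication by \<open>K\<close> scales the determinant of two rows by \<open>det K = 1\<close>,
  which gives the cocycle identity.\<close>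

lemma jacobi_mult_assoc:
  assumes "k \<in> jacobi_group"
  shows "jacobi_mult (jacobi_mult g h) k = jacobi_mult g (jacobi_mult h k)"
proof -
  obtain M X a where g: "g = (M, X, a)" by (cases g)
  obtain N Y b where h: "h = (N, Y, b)" by (cases h)
  obtain K Z c where k: "k = (K, Z, c)" by (cases k)
  have "K$1$1 * K$2$2 - K$1$2 * K$2$1 = 1"
    using assms by (simp add: k jacobi_group_def det_2)
  then have "det (vector [(X v* N + Y) v* K, Z] :: real^2^2) + det (vector [X v* N, Y] :: real^2^2) =
      det (vector [X v* (N ** K), Y v* K + Z] :: real^2^2) + det (vector [Y v* K, Z] :: real^2^2)"
    by (simp add: det_2 matrix_matrix_mult_def vector_matrix_mult_def sum_2) algebra
  then show ?thesis
    by (simp add: g h k matrix_mul_assoc vector_matrix_mul_assoc vector_matrix_left_distrib)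
qed

definition jacobi_one :: jacobi where
  "jacobi_one = (mat 1, 0, 0)"

lemma jacobi_mult_one [simp]:
  "jacobi_mult jacobi_one g = g" "jacobi_mult g jacobi_one = g"
  by (cases g; simp add: jacobi_one_def det_2)+

text \<open>An invertible idempotent matrix is the identity; then \<open>X + X = X\<close>, and the
  determinant of two equal rows vanishes, so \<open>a + a = a\<close>. This identifies the value at
  \<open>0\<close> of a one-parameter subgroup.\<close>

lemma jacobi_idempotent:
  assumes "g \<in> jacobi_group" "jacobi_mult g g = g"
  shows "g = jacobi_one"
proof -
  obtain M X a where g: "g = (M, X, a)" by (cases g)
  have "invertible M" "M ** M = M" using assms by (auto simp: g jacobi_group_def invertible_det_nz)
  then have "M = mat 1"
    by (metis invertible_left_inverse matrix_mul_assoc matrix_mul_lid)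
  then show ?thesis using assms(2) by (simp add: g jacobi_one_def det_2)
qed

section \<open>Uniqueness of one-parameter subgroups and the exponential\<close>

lemma one_parameter_subgroup_0:
  assumes "one_parameter_subgroup A \<phi>"
  shows "\<phi> 0 = jacobi_one"
  using assms jacobi_idempotent[of "\<phi> 0"] unfolding one_parameter_subgroup_def
  by (metis add_0)

lemma one_parameter_subgroup_minus:
  assumes "one_parameter_subgroup A \<phi>"
  shows "jacobi_mult (\<phi> t) (\<phi> (- t)) = jacobi_one"
  using assms one_parameter_subgroup_0[OF assms] unfolding one_parameter_subgroup_def
  by (metis add.right_inverse)

text \<open>With one factor fixed at the identity, multiplication is the identity map in the other,
  so both partial derivatives are the identity; linearity adds them.\<close>

lemma jacobi_mult_has_derivative_one:
  "((\<lambda>z. jacobi_mult (fst z) (snd z)) has_derivative (\<lambda>z. fst z + snd z)) (at (jacobi_one, jacobi_one))"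
proof -
  let ?m = "\<lambda>z. jacobi_mult (fst z) (snd z)"
  let ?e = jacobi_one
  have "?m differentiable (at (?e, ?e))"
    by (intro jacobi_mult_differentiable differentiable_fst_snd differentiable_ident)
  then obtain D where D: "(?m has_derivative D) (at (?e, ?e))" unfolding differentiable_def by blast
  have D1: "D (u, 0) = u" for u
  proof -
    have "((\<lambda>g. ?m (g, ?e)) has_derivative (\<lambda>u. D (u, 0))) (at ?e)"
      by (rule has_derivative_compose[where f = "\<lambda>g. (g, ?e)" and g = ?m and g' = D, OF _ D])
        (auto intro!: derivative_eq_intros)
    then have "((\<lambda>g. g) has_derivative (\<lambda>u. D (u, 0))) (at ?e)" by simp
    then have "(\<lambda>u. D (u, 0)) = (\<lambda>u. u)"
      by (rule has_derivative_unique) (rule has_derivative_ident)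
    then show ?thesis by metis
  qed
  have D2: "D (0, v) = v" for v
  proof -
    have "((\<lambda>g. ?m (?e, g)) has_derivative (\<lambda>u. D (0, u))) (at ?e)"
      by (rule has_derivative_compose[where f = "\<lambda>g. (?e, g)" and g = ?m and g' = D, OF _ D])
        (auto intro!: derivative_eq_intros)
    then have "((\<lambda>g. g) has_derivative (\<lambda>u. D (0, u))) (at ?e)" by simp
    then have "(\<lambda>u. D (0, u)) = (\<lambda>u. u)"
      by (rule has_derivative_unique) (rule has_derivative_ident)
    then show ?thesis by metis
  qed
  have "D = (\<lambda>z. fst z + snd z)"
  proof
    fix z show "D z = fst z + snd z"
      using linear_add[OF has_derivative_linear[OF D], of "(fst z, 0)" "(0, snd z)"] D1 D2 by simp
  qed
  with D show ?thesis by simp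
qed

text \<open>Needed for the definite description in \<open>jacobi_exp\<close> to denote the subgroup
  that is written down.\<close>

lemma one_parameter_subgroup_unique:
  assumes \<phi>: "one_parameter_subgroup A \<phi>" and \<psi>: "one_parameter_subgroup A \<psi>"
  shows "\<phi> = \<psi>"
proof -
  note hom = \<phi>[unfolded one_parameter_subgroup_def] \<psi>[unfolded one_parameter_subgroup_def]
  note zero = one_parameter_subgroup_0[OF \<phi>] one_parameter_subgroup_0[OF \<psi>]
  define \<rho> where "\<rho> t = jacobi_mult (\<phi> t) (\<psi> (- t))" for t
  have d\<psi>: "((\<lambda>s. \<psi> (- s)) has_derivative (\<lambda>s. - s *\<^sub>R A)) (at 0)"
    by (rule has_derivative_compose[of uminus uminus 0 UNIV \<psi> "\<lambda>s. s *\<^sub>R A"])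
      (use hom in \<open>auto simp: has_vector_derivative_def intro!: derivative_eq_intros\<close>)
  have "((\<lambda>s. (\<phi> s, \<psi> (- s))) has_derivative (\<lambda>s. (s *\<^sub>R A, - s *\<^sub>R A))) (at 0)"
    by (rule has_derivative_Pair[OF _ d\<psi>]) (use hom in \<open>auto simp: has_vector_derivative_def\<close>)
  \<comment> \<open>The velocities \<open>A\<close> and \<open>- A\<close> cancel, since
    multiplication differentiates to addition at the identity.\<close>
  from has_derivative_compose[OF this, of "\<lambda>z. jacobi_mult (fst z) (snd z)" "\<lambda>z. fst z + snd z"]
  have \<rho>0: "(\<rho> has_derivative (\<lambda>s. 0)) (at 0)"
    using jacobi_mult_has_derivative_one zero by (simp add: \<rho>_def[abs_def])
  have "(\<rho> has_derivative (\<lambda>s. 0)) (at t)" for t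
  proof -
    \<comment> \<open>\<open>?L\<close> carries the curve near parameter \<open>0\<close> to the
      curve near \<open>t\<close>, because \<open>\<psi> (- (t + s))\<close> factors with
      \<open>\<psi> (- t)\<close> on the right; the zero derivative is carried along.\<close>
    let ?L = "\<lambda>h. jacobi_mult (\<phi> t) (jacobi_mult h (\<psi> (- t)))"
    have "?L differentiable (at (\<rho> 0))"
      by (intro jacobi_mult_differentiable differentiable_const differentiable_ident)
    then obtain D where D: "(?L has_derivative D) (at (\<rho> 0))" unfolding differentiable_def by blast
    have shift: "\<rho> (t + s) = ?L (\<rho> s)" for s
    proof -
      have "\<psi> (- (t + s)) = jacobi_mult (\<psi> (- s)) (\<psi> (- t))"
        using hom by (metis minus_add)
      moreover have "jacobi_mult (\<psi> (- s)) (\<psi> (- t)) \<in> jacobi_group"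
        using hom by metis
      ultimately show ?thesis using hom by (simp add: \<rho>_def jacobi_mult_assoc)
    qed
    have "((\<lambda>s. ?L (\<rho> s)) has_derivative (\<lambda>s. D 0)) (at 0)"
      by (rule has_derivative_compose[OF \<rho>0 D])
    then have "((\<lambda>s. \<rho> (t + s)) has_derivative (\<lambda>s. 0)) (at 0)"
      using linear_0[OF has_derivative_linear[OF D]] by (simp add: shift)
    then have "((\<lambda>s. \<rho> (t + (s - t))) has_derivative (\<lambda>s. 0)) (at t)"
      by (intro has_derivative_compose[where f = "\<lambda>s. s - t" and f' = "\<lambda>s. s"
            and g = "\<lambda>s. \<rho> (t + s)" and g' = "\<lambda>s. 0"])
        (auto intro!: derivative_eq_intros)
    then show ?thesis by simp
  qed
  then have "\<rho> t = \<rho> 0" for t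
    by (intro has_derivative_zero_unique[of UNIV]) auto
  then have one: "jacobi_mult (\<phi> t) (\<psi> (- t)) = jacobi_one" for t
    using zero by (simp add: \<rho>_def)
  show ?thesis
  proof
    fix t
    have "\<phi> t = jacobi_mult (\<phi> t) (jacobi_mult (\<psi> (- t)) (\<psi> t))"
      using one_parameter_subgroup_minus[OF \<psi>, of "- t"] by simp
    also have "\<dots> = jacobi_mult (jacobi_mult (\<phi> t) (\<psi> (- t))) (\<psi> t)"
      using hom by (simp add: jacobi_mult_assoc)
    finally show "\<phi> t = \<psi> t" by (simp add: one)
  qed
qed

text \<open>The rescaled curve \<open>\<lambda>s. \<phi> (s * t)\<close> is the subgroup with
  velocity \<open>t *\<^sub>R A\<close>, and its value at \<open>1\<close> is
  \<open>\<phi> t\<close>.\<close>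

lemma jacobi_exp_scaleR:
  assumes "one_parameter_subgroup A \<phi>"
  shows "jacobi_exp (t *\<^sub>R A) = \<phi> t"
proof -
  have "((\<lambda>s. \<phi> (s * t)) has_derivative (\<lambda>s. (s * t) *\<^sub>R A)) (at 0)"
    by (rule has_derivative_compose[of "\<lambda>s. s * t" "\<lambda>s. s * t" 0 UNIV \<phi> "\<lambda>s. s *\<^sub>R A"])
      (use assms in \<open>auto simp: one_parameter_subgroup_def has_vector_derivative_def intro!: derivative_eq_intros\<close>)
  then have "one_parameter_subgroup (t *\<^sub>R A) (\<lambda>s. \<phi> (s * t))"
    using assms by (simp add: one_parameter_subgroup_def has_vector_derivative_def distrib_right)
  then have "(THE \<psi>. one_parameter_subgroup (t *\<^sub>R A) \<psi>) = (\<lambda>s. \<phi> (s * t))"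
    by (intro the_equality) (auto intro: one_parameter_subgroup_unique)
  then show ?thesis by (simp add: jacobi_exp_def)
qed

subsection \<open>Fundamental vector fields\<close>

text \<open>Reduces the velocity condition to real derivatives of matrix and vector entries, which
  explicit curves satisfy by routine differentiation.\<close>

lemma one_parameter_subgroupI:
  assumes "\<And>t. \<phi> t = (M t, X t, k t)"
    and "\<And>t. det (M t) = 1"
    and "\<And>s t. \<phi> (s + t) = jacobi_mult (\<phi> s) (\<phi> t)"
    and "\<forall>i j. ((\<lambda>t. M t $ i $ j) has_real_derivative A $ i $ j) (at 0)"
    and "\<forall>i. ((\<lambda>t. X t $ i) has_real_derivative Y $ i) (at 0)"
    and "(k has_real_derivative r) (at 0)"
  shows "one_parameter_subgroup (A, Y, r) \<phi>"
proof -
  have "(M has_derivative (\<lambda>h. h *\<^sub>R A)) (at 0)" "(X has_derivative (\<lambda>h. h *\<^sub>R Y)) (at 0)"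
    "(k has_derivative (\<lambda>h. h *\<^sub>R r)) (at 0)"
    using assms(4-6) by (auto intro!: has_derivative_vecI simp: has_field_derivative_def mult_commute_abs)
  then have "((\<lambda>t. (M t, X t, k t)) has_derivative (\<lambda>h. (h *\<^sub>R A, h *\<^sub>R Y, h *\<^sub>R r))) (at 0)"
    by (intro has_derivative_Pair)
  moreover have "\<phi> = (\<lambda>t. (M t, X t, k t))" using assms(1) by blast
  ultimately have "(\<phi> has_derivative (\<lambda>h. h *\<^sub>R (A, Y, r))) (at 0)" by simp
  then show ?thesis
    using assms(1-3) by (simp add: one_parameter_subgroup_def has_vector_derivative_def jacobi_group_def)
qed

lemma fundamental_vector_fieldI:
  assumes "one_parameter_subgroup A \<phi>"
    and "\<And>m. m \<in> ext_SJ \<Longrightarrow>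
      \<forall>i. ((\<lambda>t. jacobi_act (\<phi> t) m $ i) has_real_derivative V m $ i) (at 0)"
  shows "fundamental_vector_field A V"
  unfolding fundamental_vector_field_def jacobi_exp_scaleR[OF assms(1)] has_vector_derivative_def
  using assms(2)
  by (auto intro!: has_derivative_vecI simp: has_field_derivative_def mult_commute_abs)

section \<open>Explicit exponentials of the six generators\<close>

lemma mat_nth: "mat k $ i $ j = (if i = j then k else 0)"
  by (simp add: mat_def)

text \<open>The matrix of \<open>gen_F\<close> squares to zero, so its exponential is unipotent and
  acts on \<open>\<tau>\<close> by the translation \<open>\<tau> + t\<close>.\<close>

lemma fundamental_vector_field_F: "fundamental_vector_field gen_F F_star"
proof (rule fundamental_vector_fieldI)
  let ?M = "\<lambda>t::real. vector [vector [1, t], vector [0, 1]] :: real^2^2"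
  let ?\<phi> = "\<lambda>t::real. (?M t, 0, 0) :: jacobi"
  have d: "det (?M t) = 1" for t :: real
    by (simp add: det_2 mat_nth)
  show "one_parameter_subgroup gen_F ?\<phi>"
    unfolding gen_F_def
    by (rule one_parameter_subgroupI, rule refl, rule d)
      (auto simp: vec_eq_iff forall_2 matrix_matrix_mult_def sum_2 det_2 mat_nth
        intro!: derivative_eq_intros)
  fix m assume "m \<in> ext_SJ"
  then show "\<forall>i. ((\<lambda>t. jacobi_act (?\<phi> t) m $ i) has_real_derivative F_star m $ i) (at 0)"
    unfolding forall_5 jacobi_act.simps Let_def matrix_inv_SL2[OF d] vector_5 vector_2 F_star_def
    by (auto simp: ext_SJ_def vector_matrix_mult_def sum_2 mat_nth Re_divide Im_divide power2_eq_square
        intro!: derivative_eq_intros)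
qed

text \<open>The flow on \<open>\<tau>\<close> is \<open>\<tau> / (t * \<tau> + 1)\<close>, with
  derivative \<open>- \<tau>\<^sup>2\<close> at \<open>t = 0\<close>; this explains the quadratic
  coefficients.\<close>

lemma fundamental_vector_field_G: "fundamental_vector_field gen_G G_star"
proof (rule fundamental_vector_fieldI)
  let ?M = "\<lambda>t::real. vector [vector [1, 0], vector [t, 1]] :: real^2^2"
  let ?\<phi> = "\<lambda>t::real. (?M t, 0, 0) :: jacobi"
  have d: "det (?M t) = 1" for t :: real
    by (simp add: det_2 mat_nth)
  show "one_parameter_subgroup gen_G ?\<phi>"
    unfolding gen_G_def
    by (rule one_parameter_subgroupI, rule refl, rule d)
      (auto simp: vec_eq_iff forall_2 matrix_matrix_mult_def sum_2 det_2 mat_nth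
        intro!: derivative_eq_intros)
  fix m assume "m \<in> ext_SJ"
  then show "\<forall>i. ((\<lambda>t. jacobi_act (?\<phi> t) m $ i) has_real_derivative G_star m $ i) (at 0)"
    unfolding forall_5 jacobi_act.simps Let_def matrix_inv_SL2[OF d] vector_5 vector_2 G_star_def
    by (auto simp: ext_SJ_def vector_matrix_mult_def sum_2 mat_nth Re_divide Im_divide power2_eq_square
        intro!: derivative_eq_intros)
qed

text \<open>The diagonal flow scales \<open>\<tau>\<close> by \<open>exp (2 * t)\<close>,
  \<open>p\<close> by \<open>exp (- t)\<close> and \<open>q\<close> by \<open>exp t\<close>.\<close>

lemma fundamental_vector_field_H: "fundamental_vector_field gen_H H_star"
proof (rule fundamental_vector_fieldI)
  let ?M = "\<lambda>t::real. vector [vector [exp t, 0], vector [0, exp (- t)]] :: real^2^2"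
  let ?\<phi> = "\<lambda>t::real. (?M t, 0, 0) :: jacobi"
  have d: "det (?M t) = 1" for t :: real
    by (simp add: det_2 mat_nth flip: exp_add)
  show "one_parameter_subgroup gen_H ?\<phi>"
    unfolding gen_H_def
    by (rule one_parameter_subgroupI, rule refl, rule d)
      (auto simp: vec_eq_iff forall_2 matrix_matrix_mult_def sum_2 det_2 mat_nth mult_exp_exp
        intro!: derivative_eq_intros)
  fix m assume "m \<in> ext_SJ"
  then show "\<forall>i. ((\<lambda>t. jacobi_act (?\<phi> t) m $ i) has_real_derivative H_star m $ i) (at 0)"
    unfolding forall_5 jacobi_act.simps Let_def matrix_inv_SL2[OF d] vector_5 vector_2 H_star_def
    by (auto simp: ext_SJ_def vector_matrix_mult_def sum_2 mat_nth Re_divide Im_divide power2_eq_square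
        intro!: derivative_eq_intros)
qed

text \<open>A straight line in the Heisenberg group is a subgroup, since the determinant of two
  parallel rows vanishes. The \<open>\<kappa>\<close> coefficient comes from the twist in the
  action.\<close>

lemma fundamental_vector_field_P: "fundamental_vector_field gen_P P_star"
proof (rule fundamental_vector_fieldI)
  let ?M = "\<lambda>_::real. mat 1 :: real^2^2"
  let ?\<phi> = "\<lambda>t::real. (?M t, vector [t, 0], 0) :: jacobi"
  have d: "det (?M t) = 1" for t :: real
    by (simp add: det_2 mat_nth)
  show "one_parameter_subgroup gen_P ?\<phi>"
    unfolding gen_P_def
    by (rule one_parameter_subgroupI, rule refl, rule d)
      (auto simp: vec_eq_iff forall_2 matrix_matrix_mult_def sum_2 det_2 mat_nth
        intro!: derivative_eq_intros)
  fix m assume "m \<in> ext_SJ"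
  then show "\<forall>i. ((\<lambda>t. jacobi_act (?\<phi> t) m $ i) has_real_derivative P_star m $ i) (at 0)"
    unfolding forall_5 jacobi_act.simps Let_def matrix_inv_SL2[OF d] vector_5 vector_2 P_star_def
    by (auto simp: ext_SJ_def vector_matrix_mult_def sum_2 mat_nth Re_divide Im_divide power2_eq_square
        intro!: derivative_eq_intros)
qed

lemma fundamental_vector_field_Q: "fundamental_vector_field gen_Q Q_star"
proof (rule fundamental_vector_fieldI)
  let ?M = "\<lambda>_::real. mat 1 :: real^2^2"
  let ?\<phi> = "\<lambda>t::real. (?M t, vector [0, t], 0) :: jacobi"
  have d: "det (?M t) = 1" for t :: real
    by (simp add: det_2 mat_nth)
  show "one_parameter_subgroup gen_Q ?\<phi>"
    unfolding gen_Q_def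
    by (rule one_parameter_subgroupI, rule refl, rule d)
      (auto simp: vec_eq_iff forall_2 matrix_matrix_mult_def sum_2 det_2 mat_nth
        intro!: derivative_eq_intros)
  fix m assume "m \<in> ext_SJ"
  then show "\<forall>i. ((\<lambda>t. jacobi_act (?\<phi> t) m $ i) has_real_derivative Q_star m $ i) (at 0)"
    unfolding forall_5 jacobi_act.simps Let_def matrix_inv_SL2[OF d] vector_5 vector_2 Q_star_def
    by (auto simp: ext_SJ_def vector_matrix_mult_def sum_2 mat_nth Re_divide Im_divide power2_eq_square
        intro!: derivative_eq_intros)
qed

lemma fundamental_vector_field_R: "fundamental_vector_field gen_R R_star"
proof (rule fundamental_vector_fieldI)
  let ?M = "\<lambda>_::real. mat 1 :: real^2^2"
  let ?\<phi> = "\<lambda>t::real. (?M t, 0, t) :: jacobi"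
  have d: "det (?M t) = 1" for t :: real
    by (simp add: det_2 mat_nth)
  show "one_parameter_subgroup gen_R ?\<phi>"
    unfolding gen_R_def
    by (rule one_parameter_subgroupI, rule refl, rule d)
      (auto simp: vec_eq_iff forall_2 matrix_matrix_mult_def sum_2 det_2 mat_nth
        intro!: derivative_eq_intros)
  fix m assume "m \<in> ext_SJ"
  then show "\<forall>i. ((\<lambda>t. jacobi_act (?\<phi> t) m $ i) has_real_derivative R_star m $ i) (at 0)"
    unfolding forall_5 jacobi_act.simps Let_def matrix_inv_SL2[OF d] vector_5 vector_2 R_star_def
    by (auto simp: ext_SJ_def vector_matrix_mult_def sum_2 mat_nth Re_divide Im_divide power2_eq_square
        intro!: derivative_eq_intros)
qed

subsection \<open>Killing equations\<close>

text \<open>The differential of the metric matrix at \<open>m\<close> in direction \<open>v\<close>.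
  The third diagonal entry differentiates \<open>\<gamma> / y * (x\<^sup>2 + y\<^sup>2)\<close> as
  \<open>\<gamma> * (x\<^sup>2 / y + y)\<close>.\<close>

definition SJ_metric_deriv :: "real \<Rightarrow> real \<Rightarrow> real \<Rightarrow> real^5 \<Rightarrow> real^5 \<Rightarrow> real^5^5" where
  "SJ_metric_deriv \<alpha> \<gamma> \<delta> m v =
     (let x = m $ 1; y = m $ 2; p = m $ 3; q = m $ 4;
          a = - 2 * \<alpha> * v $ 2 / y ^ 3;
          b = \<gamma> * (v $ 1 / y - x * v $ 2 / y\<^sup>2) - \<delta> * (v $ 3 * q + p * v $ 4)
      in vector
        [vector [a, 0, 0, 0, 0],
         vector [0, a, 0, 0, 0],
         vector [0, 0, \<gamma> * (2 * x * v $ 1 / y + v $ 2 - x\<^sup>2 * v $ 2 / y\<^sup>2) + 2 * \<delta> * q * v $ 4, b, \<delta> * v $ 4],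
         vector [0, 0, b, - \<gamma> * v $ 2 / y\<^sup>2 + 2 * \<delta> * p * v $ 3, - \<delta> * v $ 3],
         vector [0, 0, \<delta> * v $ 4, - \<delta> * v $ 3, 0]])"

lemma SJ_metric_has_derivative:
  assumes "m \<in> ext_SJ"
  shows "((\<lambda>z. SJ_metric \<alpha> \<gamma> \<delta> z $ l $ c) has_derivative
    (\<lambda>v. SJ_metric_deriv \<alpha> \<gamma> \<delta> m v $ l $ c)) (at m)"
proof -
  have y: "m $ 2 > 0" using assms by (simp add: ext_SJ_def)
  \<comment> \<open>Quantifying over the indices lets \<open>forall_5\<close> split the claim into
    25 scalar derivatives.\<close>
  have "\<forall>l c. ((\<lambda>z. SJ_metric \<alpha> \<gamma> \<delta> z $ l $ c) has_derivative
    (\<lambda>v. SJ_metric_deriv \<alpha> \<gamma> \<delta> m v $ l $ c)) (at m)"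
    unfolding forall_5 SJ_metric_def SJ_metric_deriv_def Let_def vector_5
    using y
    by (auto intro!: derivative_eq_intros simp: fun_eq_iff field_simps power2_eq_square power3_eq_cube)
  then show ?thesis by blast
qed

text \<open>Once derivatives of \<open>g\<close> and \<open>V\<close> are known, each
  \<open>partial\<close> is their value on a coordinate vector, and the differential equations
  become algebraic identities.\<close>

lemma killing_equationsI:
  assumes "\<And>m l c. m \<in> ext_SJ \<Longrightarrow> ((\<lambda>z. g z $ l $ c) has_derivative (\<lambda>v. dg m v $ l $ c)) (at m)"
    and "\<And>m. \<forall>k. ((\<lambda>z. V z $ k) has_derivative (\<lambda>v. dV m v $ k)) (at m)"
    and "\<And>m. m \<in> ext_SJ \<Longrightarrow> \<forall>l c.
      (\<Sum>k\<in>UNIV. V m $ k * dg m (axis k 1) $ l $ c + g m $ k $ c * dV m (axis l 1) $ k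
         + g m $ l $ k * dV m (axis c 1) $ k) = 0"
  shows "killing_equations g V"
  unfolding killing_equations_def
proof (intro ballI allI)
  fix m l c assume m: "m \<in> ext_SJ"
  have dg: "partial i (\<lambda>z. g z $ l $ c) m = dg m (axis i 1) $ l $ c" for i
    unfolding partial_def frechet_derivative_at[OF assms(1)[OF m], symmetric] ..
  have dV: "partial i (\<lambda>z. V z $ k) m = dV m (axis i 1) $ k" for i k
    unfolding partial_def frechet_derivative_at[OF assms(2)[rule_format], symmetric] ..
  show "(\<Sum>k\<in>UNIV. V m $ k * partial k (\<lambda>z. g z $ l $ c) m + g m $ k $ c * partial l (\<lambda>z. V z $ k) m
      + g m $ l $ k * partial c (\<lambda>z. V z $ k) m) = 0"
    using assms(3)[OF m] by (simp add: dg dV)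
qed

lemma killing_SJI:
  assumes "\<And>m. \<forall>k. ((\<lambda>z. V z $ k) has_derivative (\<lambda>v. dV m v $ k)) (at m)"
    and "\<And>m. m \<in> ext_SJ \<Longrightarrow> \<forall>l c.
      (\<Sum>k\<in>UNIV. V m $ k * SJ_metric_deriv \<alpha> \<gamma> \<delta> m (axis k 1) $ l $ c
         + SJ_metric \<alpha> \<gamma> \<delta> m $ k $ c * dV m (axis l 1) $ k
         + SJ_metric \<alpha> \<gamma> \<delta> m $ l $ k * dV m (axis c 1) $ k) = 0"
  shows "killing_equations (SJ_metric \<alpha> \<gamma> \<delta>) V"
  using SJ_metric_has_derivative assms by (rule killing_equationsI)

section \<open>Verification for the six fields\<close>

lemmas killing_simps = forall_5 sum_5 SJ_metric_def SJ_metric_deriv_def Let_def axis_def ext_SJ_def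

lemma killing_equations_F: "killing_equations (SJ_metric \<alpha> \<gamma> \<delta>) F_star"
  by (rule killing_SJI[where dV = "\<lambda>m v. vector [0, 0, 0, - v $ 3, 0]"])
    (auto simp: F_star_def killing_simps field_simps power2_eq_square power3_eq_cube fun_eq_iff
      intro!: derivative_eq_intros)

text \<open>The first two entries of \<open>dV\<close> are the real and imaginary parts of
  \<open>- 2 * \<tau> * d\<tau>\<close>, the differential of \<open>- \<tau>\<^sup>2\<close>. The
  other five fields are affine, so their \<open>dV\<close> is independent of
  \<open>m\<close>.\<close>

lemma killing_equations_G: "killing_equations (SJ_metric \<alpha> \<gamma> \<delta>) G_star"
  by (rule killing_SJI[where dV = "\<lambda>m v. vector [2 * m $ 2 * v $ 2 - 2 * m $ 1 * v $ 1,
        - 2 * (m $ 1 * v $ 2 + m $ 2 * v $ 1), - v $ 4, 0, 0]"])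
    (auto simp: G_star_def killing_simps field_simps power2_eq_square power3_eq_cube fun_eq_iff
      intro!: derivative_eq_intros)

lemma killing_equations_H: "killing_equations (SJ_metric \<alpha> \<gamma> \<delta>) H_star"
  by (rule killing_SJI[where dV = "\<lambda>m v. vector [2 * v $ 1, 2 * v $ 2, - v $ 3, v $ 4, 0]"])
    (auto simp: H_star_def killing_simps field_simps power2_eq_square power3_eq_cube fun_eq_iff
      intro!: derivative_eq_intros)

lemma killing_equations_P: "killing_equations (SJ_metric \<alpha> \<gamma> \<delta>) P_star"
  by (rule killing_SJI[where dV = "\<lambda>m v. vector [0, 0, 0, 0, v $ 4]"])
    (auto simp: P_star_def killing_simps field_simps power2_eq_square power3_eq_cube fun_eq_iff
      intro!: derivative_eq_intros)

lemma killing_equations_Q: "killing_equations (SJ_metric \<alpha> \<gamma> \<delta>) Q_star"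
  by (rule killing_SJI[where dV = "\<lambda>m v. vector [0, 0, 0, 0, - v $ 3]"])
    (auto simp: Q_star_def killing_simps field_simps power2_eq_square power3_eq_cube fun_eq_iff
      intro!: derivative_eq_intros)

lemma killing_equations_R: "killing_equations (SJ_metric \<alpha> \<gamma> \<delta>) R_star"
  by (rule killing_SJI[where dV = "\<lambda>m v. vector [0, 0, 0, 0, 0]"])
    (auto simp: R_star_def killing_simps field_simps power2_eq_square power3_eq_cube fun_eq_iff
      intro!: derivative_eq_intros)

subsection \<open>Invariance of the metric\<close>

text \<open>The sum of squares is polarised here because invariance is demanded for pairs
  \<open>u\<close>, \<open>v\<close> of tangent vectors.\<close>

lemma SJ_metric_complex_form:
  assumes "m $ 2 > 0"
  shows "u \<bullet> (SJ_metric \<alpha> \<gamma> \<delta> m *v v) =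
    \<alpha> / (m $ 2)\<^sup>2 * Re (Complex (u $ 1) (u $ 2) * cnj (Complex (v $ 1) (v $ 2)))
    + \<gamma> / m $ 2 * Re ((Complex (m $ 1) (m $ 2) * of_real (u $ 3) + of_real (u $ 4)) *
        cnj (Complex (m $ 1) (m $ 2) * of_real (v $ 3) + of_real (v $ 4)))
    + \<delta> * (u $ 5 + m $ 4 * u $ 3 - m $ 3 * u $ 4) * (v $ 5 + m $ 4 * v $ 3 - m $ 3 * v $ 4)"
  using assms unfolding SJ_metric_def Let_def inner_vec_def matrix_vector_mult_def sum_5
  by (simp add: field_simps power2_eq_square)

text \<open>The denominator \<open>w * cnj w\<close> is real. Used with \<open>w = j\<^sup>2\<close>
  for \<open>d\<tau>\<close> and with \<open>w = j\<close> for
  \<open>\<tau> dp + dq\<close>.\<close>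

lemma Re_mult_cnj_divide: "Re (a / w * cnj (b / w)) = Re (a * cnj b) / (cmod w)\<^sup>2"
proof -
  have "a / w * cnj (b / w) = a * cnj b / of_real ((cmod w)\<^sup>2)"
    by (simp add: complex_norm_square del: of_real_power)
  then show ?thesis by (simp only: Re_divide_of_real)
qed

lemma left_invariant_SJ_metric: "left_invariant_metric (SJ_metric \<alpha> \<gamma> \<delta>)"
  unfolding left_invariant_metric_def
proof (intro ballI conjI)
  fix h :: jacobi and m :: "real^5"
  assume h: "h \<in> jacobi_group" and m: "m \<in> ext_SJ"
  then show "jacobi_act h m \<in> ext_SJ" by (rule jacobi_act_closed)
  then have y1: "jacobi_act h m $ 2 > 0" by (simp add: ext_SJ_def)
  obtain M X \<kappa> where h_eq: "h = (M, X, \<kappa>)" by (cases h)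
  have det: "det M = 1" using h by (simp add: h_eq jacobi_group_def)
  have y: "m $ 2 > 0" using m by (simp add: ext_SJ_def)
  define a b c d where abcd: "a = M $ 1 $ 1" "b = M $ 1 $ 2" "c = M $ 2 $ 1" "d = M $ 2 $ 2"
  have ad: "a * d - b * c = 1" using det by (simp add: det_2 abcd)
  define T where "T v = Complex (v $ 1) (v $ 2)" for v :: "real^5"
  define \<mu> where "\<mu> z = (of_real a * z + of_real b) / (of_real c * z + of_real d)" for z :: complex
  define j where "j = of_real c * T m + of_real d"
  have j: "j \<noteq> 0"
    using SL2_denominator_nonzero[OF det, of "T m"] y by (simp add: j_def abcd T_def)
  \<comment> \<open>The expected differential of the action: the Moebius map contributes the factor
    \<open>1 / j\<^sup>2\<close>, and \<open>(dp, dq)\<close> is multiplied by the inverse of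
    \<open>M\<close>.\<close>
  define D :: "real^5 \<Rightarrow> real^5" where
    "D v = vector [Re (T v / j\<^sup>2), Im (T v / j\<^sup>2), d * v $ 3 - c * v $ 4, a * v $ 4 - b * v $ 3,
       v $ 5 + X $ 1 * v $ 4 - X $ 2 * v $ 3]" for v
  have act: "jacobi_act h z = vector [Re (\<mu> (T z)), Im (\<mu> (T z)),
      (X $ 1 + z $ 3) * d - (X $ 2 + z $ 4) * c,
      a * (X $ 2 + z $ 4) - b * (X $ 1 + z $ 3), \<kappa> + z $ 5 + X $ 1 * z $ 4 - X $ 2 * z $ 3]" for z
    unfolding h_eq jacobi_act.simps Let_def matrix_inv_SL2[OF det] \<mu>_def T_def vec_eq_iff forall_5 vector_5
    by (simp add: vector_matrix_mult_def sum_2 abcd algebra_simps)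
  have dT: "(T has_derivative T) (at m)"
  proof -
    have "T = (\<lambda>v. of_real (v $ 1) + \<i> * of_real (v $ 2))" by (simp add: fun_eq_iff T_def Complex_eq)
    then show ?thesis by (auto intro!: derivative_eq_intros)
  qed
  have "(\<mu> has_field_derivative (of_real a * j - (of_real a * T m + of_real b) * of_real c) / (j * j)) (at (T m))"
    unfolding \<mu>_def j_def using j[unfolded j_def] by (auto intro!: derivative_eq_intros)
  \<comment> \<open>The numerator of the quotient rule collapses to the determinant.\<close>
  moreover have "of_real a * j - (of_real a * T m + of_real b) * of_real c = of_real (a * d - b * c)"
    by (simp add: j_def algebra_simps)
  ultimately have "(\<mu> has_field_derivative 1 / j\<^sup>2) (at (T m))" by (simp add: ad power2_eq_square)
  then have "((\<lambda>z. \<mu> (T z)) has_derivative (\<lambda>v. T v / j\<^sup>2)) (at m)"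
    using has_derivative_compose[OF dT] by (fastforce simp: has_field_derivative_def)
  note d\<mu> = this[THEN has_derivative_Re] this[THEN has_derivative_Im]
  have "\<forall>i. ((\<lambda>z. jacobi_act h z $ i) has_derivative (\<lambda>v. D v $ i)) (at m)"
    unfolding act D_def forall_5 vector_5
    by (intro conjI d\<mu>) (auto intro!: derivative_eq_intros simp: algebra_simps)
  then have deriv: "(jacobi_act h has_derivative D) (at m)"
    by (intro has_derivative_vecI) simp
  have im: "jacobi_act h m $ 2 = m $ 2 / (cmod j)\<^sup>2"
  proof -
    \<comment> \<open>Expanding by \<open>cnj j\<close> makes the denominator real, so the imaginary
      part is read off the numerator.\<close>
    have "\<mu> (T m) = (of_real a * T m + of_real b) * cnj j / of_real ((cmod j)\<^sup>2)"
      using j by (simp add: \<mu>_def j_def[symmetric] complex_norm_square del: of_real_power)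
    then have "Im (\<mu> (T m)) = Im ((of_real a * T m + of_real b) * cnj j) / (cmod j)\<^sup>2"
      by (simp only: Im_divide_of_real)
    also have "Im ((of_real a * T m + of_real b) * cnj j) = (a * d - b * c) * m $ 2"
      by (simp add: j_def T_def algebra_simps)
    finally show ?thesis by (simp add: act ad)
  qed
  have TD: "T (D v) = T v / j\<^sup>2" for v
    by (subst T_def) (simp only: D_def vector_5 complex_surj)
  define w where "w z v = T z * of_real (v $ 3) + of_real (v $ 4)" for z v :: "real^5"
  have wD: "w (jacobi_act h m) (D v) = w m v / j" for v
  proof -
    have "T (jacobi_act h m) = (of_real a * T m + of_real b) / j"
      by (simp add: act T_def[of "vector _"] \<mu>_def j_def complex_eq_iff)
    then have Tj: "T (jacobi_act h m) * j = of_real a * T m + of_real b"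
      using j by simp
    \<comment> \<open>After clearing \<open>j\<close>, the mixed terms cancel and
      \<open>a * d - b * c\<close> factors out.\<close>
    have "w (jacobi_act h m) (D v) * j = T (jacobi_act h m) * j * of_real (d * v $ 3 - c * v $ 4)
        + of_real (a * v $ 4 - b * v $ 3) * j"
      by (simp add: w_def D_def algebra_simps)
    also have "\<dots> = of_real (a * d - b * c) * w m v"
      unfolding Tj by (simp add: j_def w_def algebra_simps)
    finally show ?thesis using j by (simp add: ad field_simps)
  qed
  define \<theta> where "\<theta> z v = v $ 5 + z $ 4 * v $ 3 - z $ 3 * v $ 4" for z v :: "real^5"
  \<comment> \<open>The inverse of \<open>M\<close> preserves the determinant of the rows
    \<open>(p, q)\<close> and \<open>(dp, dq)\<close>; the terms left by the shift \<open>X\<close>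
    cancel those in the last entry of \<open>D\<close>.\<close>
  have \<theta>D: "\<theta> (jacobi_act h m) (D v) = \<theta> m v" for v
    unfolding \<theta>_def act D_def vector_5 using ad by algebra
  have form: "u \<bullet> (SJ_metric \<alpha> \<gamma> \<delta> z *v v) = \<alpha> / (z $ 2)\<^sup>2 * Re (T u * cnj (T v))
      + \<gamma> / z $ 2 * Re (w z u * cnj (w z v)) + \<delta> * \<theta> z u * \<theta> z v" if "z $ 2 > 0" for u v z
    using SJ_metric_complex_form[OF that] by (simp only: T_def w_def \<theta>_def)
  have "D u \<bullet> (SJ_metric \<alpha> \<gamma> \<delta> (jacobi_act h m) *v D v) = u \<bullet> (SJ_metric \<alpha> \<gamma> \<delta> m *v v)" for u v
  proof -
    define N where "N = (cmod j)\<^sup>2"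
    have N: "N \<noteq> 0" "(cmod (j\<^sup>2))\<^sup>2 = N\<^sup>2" using j by (simp_all add: N_def norm_power)
    \<comment> \<open>The powers of \<open>N\<close> from the height and from the forms balance: two
      in the \<open>\<alpha>\<close> term, one in the \<open>\<gamma>\<close> term.\<close>
    have "\<alpha> / (m $ 2 / N)\<^sup>2 * (A / N\<^sup>2) = \<alpha> / (m $ 2)\<^sup>2 * A"
      "\<gamma> / (m $ 2 / N) * (A / N) = \<gamma> / m $ 2 * A" for A
      using N(1) y by (simp_all add: power_divide)
    then show ?thesis
      by (simp only: form[OF y] form[OF y1] TD wD \<theta>D Re_mult_cnj_divide im N(2) N_def[symmetric])
  qed
  with deriv show "\<exists>D. (jacobi_act h has_derivative D) (at m) \<and>
      (\<forall>u v. D u \<bullet> (SJ_metric \<alpha> \<gamma> \<delta> (jacobi_act h m) *v D v) = u \<bullet> (SJ_metric \<alpha> \<gamma> \<delta> m *v v))"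
    by blast
qed

theorem proposition4:
  fixes \<alpha> \<gamma> \<delta> :: real
  assumes "\<alpha> > 0" and "\<gamma> > 0" and "\<delta> > 0"
  shows "left_invariant_metric (SJ_metric \<alpha> \<gamma> \<delta>) \<and>
    (fundamental_vector_field gen_F F_star \<and> killing_equations (SJ_metric \<alpha> \<gamma> \<delta>) F_star) \<and>
    (fundamental_vector_field gen_G G_star \<and> killing_equations (SJ_metric \<alpha> \<gamma> \<delta>) G_star) \<and>
    (fundamental_vector_field gen_H H_star \<and> killing_equations (SJ_metric \<alpha> \<gamma> \<delta>) H_star) \<and>
    (fundamental_vector_field gen_P P_star \<and> killing_equations (SJ_metric \<alpha> \<gamma> \<delta>) P_star) \<and>
    (fundamental_vector_field gen_Q Q_star \<and> killing_equations (SJ_metric \<alpha> \<gamma> \<delta>) Q_star) \<and>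
    (fundamental_vector_field gen_R R_star \<and> killing_equations (SJ_metric \<alpha> \<gamma> \<delta>) R_star)"
  by (intro conjI left_invariant_SJ_metric
      fundamental_vector_field_F fundamental_vector_field_G fundamental_vector_field_H
      fundamental_vector_field_P fundamental_vector_field_Q fundamental_vector_field_R
      killing_equations_F killing_equations_G killing_equations_H
      killing_equations_P killing_equations_Q killing_equations_R)

end
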